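(* Let $\mathbb K=\mathbb R$ or $\mathbb C$, let $\mathbf A\in\mathbb K^{n\times n}$ be positive definite (i.e. its Hermitian part $\mathbf M(\mathbf A)$ is Hermitian positive definite), let $\mathbf H\in\mathbb K^{n\times n}$ be Hermitian positive definite, and let $\mathbf b,\mathbf x_0\in\mathbb K^n$ with $\mathbf r_0=\mathbf b-\mathbf A\mathbf x_0\ne\mathbf 0$. Apply GCR right preconditioned by $\mathbf H$ in the inner product induced by $\mathbf H$ (WHP-GCR). For every $i$ such that the $i$-th iterate is defined, its residual satisfies $$\frac{\|\mathbf r_i\|_{\mathbf H}}{\|\mathbf r_0\|_{\mathbf H}}\le\left[1-\frac{\lambda_{\min}(\mathbf H\mathbf M(\mathbf A))}{\lambda_{\max}(\mathbf H\mathbf M(\mathbf A))}\times\frac{1}{1+\rho(\mathbf M(\mathbf A)^{-1}\mathbf N(\mathbf A))^2}\right]^{i/2}.$$ The same result holds for WHP-GMRES and for all truncated and restarted versions of WHP-GCR and WHP-GMRES, i.e. WHP-GCR($k$) and WHP-GMRES($k$) ($k\ge0$), WHP-Orthomin($k$) ($k\ge1$), including WHP-MR.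
   Context: $n\ge1$. $\langle\mathbf x,\mathbf y\rangle=\mathbf y^*\mathbf x$, $\langle\mathbf x,\mathbf y\rangle_{\mathbf H}=\mathbf y^*\mathbf H\mathbf x$, $\|\mathbf x\|_{\mathbf H}=\langle\mathbf x,\mathbf x\rangle_{\mathbf H}^{1/2}$. $\mathbf M(\mathbf A)=\frac12(\mathbf A+\mathbf A^* )$ and $\mathbf N(\mathbf A)=\frac12(\mathbf A-\mathbf A^* )$ are the Hermitian and skew-Hermitian parts of $\mathbf A$. $\lambda_{\min}(\mathbf H\mathbf M(\mathbf A))$ and $\lambda_{\max}(\mathbf H\mathbf M(\mathbf A))$ are the smallest and largest eigenvalues of $\mathbf H\mathbf M(\mathbf A)$ (its eigenvalues are real and positive). $\rho(\cdot)$ is the spectral radius (largest modulus of the complex eigenvalues). WHP-GCR: set $\mathbf r_0=\mathbf b-\mathbf A\mathbf x_0$, $\mathbf z_0=\mathbf H\mathbf r_0$, $\mathbf p_0=\mathbf z_0$, $\mathbf q_0=\mathbf A\mathbf p_0$. For $i=0,1,\dots$: $\delta_i=\langle\mathbf q_i,\mathbf q_i\rangle_{\mathbf H}$, $\gamma_i=\langle\mathbf r_i,\mathbf q_i\rangle_{\mathbf H}$, $\alpha_i=\gamma_i/\delta_i$; $\mathbf x_{i+1}=\mathbf x_i+\alpha_i\mathbf p_i$, $\mathbf r_{i+1}=\mathbf r_i-\alpha_i\mathbf q_i$, $\mathbf z_{i+1}=\mathbf H\mathbf r_{i+1}$; $\beta_{i,j}=\langle\mathbf A\mathbf z_{i+1},\mathbf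 q_j\rangle_{\mathbf H}/\delta_j$ for $j=0,\dots,i$; $\mathbf p_{i+1}=\mathbf z_{i+1}-\sum_{j=0}^i\beta_{i,j}\mathbf p_j$, $\mathbf q_{i+1}=\mathbf A\mathbf z_{i+1}-\sum_{j=0}^i\beta_{i,j}\mathbf q_j$. WHP-Orthomin($k$): same algorithm except that $\mathbf p_{i+1}=\mathbf z_{i+1}-\sum_{j=\max(0,i-k+1)}^{i}\beta_{i,j}\mathbf p_j$ and $\mathbf q_{i+1}=\mathbf A\mathbf p_{i+1}$. WHP-MR: same algorithm except that $\mathbf p_{i+1}=\mathbf z_{i+1}$ and $\mathbf q_{i+1}=\mathbf A\mathbf p_{i+1}$. WHP-GMRES: $\mathbf x_i$ is the minimizer of $\|\mathbf b-\mathbf A\mathbf x\|_{\mathbf H}$ over $\mathbf x\in\mathbf x_0+\operatorname{span}\{\mathbf H\mathbf r_0,\mathbf H\mathbf A\mathbf H\mathbf r_0,\dots,(\mathbf H\mathbf A)^{i-1}\mathbf H\mathbf r_0\}$, and $\mathbf r_i=\mathbf b-\mathbf A\mathbf x_i$. WHP-GCR($k$), WHP-GMRES($k$): the method is run in cycles of $k+1$ iterations; each cycle runs WHP-GCR (respectively WHP-GMRES) from scratch with initial guess equal to the last iterate of the previous cycle, the iterates being numbered consecutively. For WHP-GCR, WHP-GCR($k$), WHP-Orthomin($k$) and WHP-MR, an iterate is defined as long as all the quantities $\delta_j$ by which the algorithm has divided to compute it are nonzero. *)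

theory Defs
  imports "HOL-Analysis.Analysis"
begin

(* The scalar field is passed as a set K of complex numbers, K = \<real> or K = UNIV; real vectors
   and matrices are those with all entries in \<real>. Products are ** and *v throughout: the
   library's * on vectors and matrices is componentwise. *)

definition vec_over :: "complex set \<Rightarrow> complex^'n \<Rightarrow> bool" where
  "vec_over K v \<longleftrightarrow> (\<forall>i. v $ i \<in> K)"

definition mat_over :: "complex set \<Rightarrow> complex^'n^'m \<Rightarrow> bool" where
  "mat_over K B \<longleftrightarrow> (\<forall>i j. B $ i $ j \<in> K)"

definition cinner :: "complex^'n \<Rightarrow> complex^'n \<Rightarrow> complex" where
  "cinner x y = (\<Sum>i\<in>UNIV. cnj (y $ i) * x $ i)"

(* cinner (H *v x) y = y* H x: linear in x, conjugate linear in y *)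
definition hinner :: "complex^'n^'n \<Rightarrow> complex^'n \<Rightarrow> complex^'n \<Rightarrow> complex" where
  "hinner H x y = cinner (H *v x) y"

definition hnorm :: "complex^'n^'n \<Rightarrow> complex^'n \<Rightarrow> real" where
  "hnorm H x = sqrt (Re (hinner H x x))"

definition ctranspose :: "complex^'n^'m \<Rightarrow> complex^'m^'n" where
  "ctranspose B = (\<chi> i j. cnj (B $ j $ i))"

definition herm_part :: "complex^'n^'n \<Rightarrow> complex^'n^'n" where
  "herm_part B = (1/2) *\<^sub>R (B + ctranspose B)"

definition skew_part :: "complex^'n^'n \<Rightarrow> complex^'n^'n" where
  "skew_part B = (1/2) *\<^sub>R (B - ctranspose B)"

(* For Hermitian B the number x* B x is real, so Re loses nothing. *)
definition hpd :: "complex set \<Rightarrow> complex^'n^'n \<Rightarrow> bool" where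
  "hpd K B \<longleftrightarrow> ctranspose B = B \<and> (\<forall>x. vec_over K x \<and> x \<noteq> 0 \<longrightarrow> Re (cinner (B *v x) x) > 0)"

definition eigvals :: "complex^'n^'n \<Rightarrow> complex set" where
  "eigvals B = {c. \<exists>v. v \<noteq> 0 \<and> B *v v = c *s v}"

definition spec_radius :: "complex^'n^'n \<Rightarrow> real" where
  "spec_radius B = Max (cmod ` eigvals B)"

(* Meant for matrices all of whose eigenvalues are real, where Re is only a type conversion. *)
definition lambda_min :: "complex^'n^'n \<Rightarrow> real" where
  "lambda_min B = Min (Re ` eigvals B)"

definition lambda_max :: "complex^'n^'n \<Rightarrow> real" where
  "lambda_max B = Max (Re ` eigvals B)"

(* The bound [rate]^(i/2) is written sqrt rate ^ i: the rate is 0 when, e.g., A = H = mat 1, and then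
   i = 0 needs 0^0 = 1, whereas 0 powr 0 = 0. *)
definition rate :: "complex^'n^'n \<Rightarrow> complex^'n^'n \<Rightarrow> real" where
  "rate A H = 1 - lambda_min (H ** herm_part A) / lambda_max (H ** herm_part A)
     * (1 / (1 + (spec_radius (matrix_inv (herm_part A) ** skew_part A))\<^sup>2))"

(* alpha_i = hcoeff H r_i q_i and beta_{i,j} = hcoeff H (A z_{i+1}) q_j; a zero denominator gives
   the value 0, and such iterates are excluded by the predicates ..._defined below. *)
definition hcoeff :: "complex^'n^'n \<Rightarrow> complex^'n \<Rightarrow> complex^'n \<Rightarrow> complex" where
  "hcoeff H u q = hinner H u q / hinner H q q"

context
  notes sum.cong [fundef_cong]
  fixes A H :: "complex^'n^'n" and b x0 :: "complex^'n"
begin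

(* The preconditioned residual z_i is H *v r_i. *)

function gcr_x :: "nat \<Rightarrow> complex^'n" and gcr_r :: "nat \<Rightarrow> complex^'n"
  and gcr_p :: "nat \<Rightarrow> complex^'n" and gcr_q :: "nat \<Rightarrow> complex^'n" where
  "gcr_x 0 = x0"
| "gcr_x (Suc i) = gcr_x i + hcoeff H (gcr_r i) (gcr_q i) *s gcr_p i"
| "gcr_r 0 = b - A *v x0"
| "gcr_r (Suc i) = gcr_r i - hcoeff H (gcr_r i) (gcr_q i) *s gcr_q i"
| "gcr_p 0 = H *v gcr_r 0"
| "gcr_p (Suc i) = H *v gcr_r (Suc i)
     - (\<Sum>j\<in>{0..i}. hcoeff H (A *v (H *v gcr_r (Suc i))) (gcr_q j) *s gcr_p j)"
| "gcr_q 0 = A *v gcr_p 0"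
| "gcr_q (Suc i) = A *v (H *v gcr_r (Suc i))
     - (\<Sum>j\<in>{0..i}. hcoeff H (A *v (H *v gcr_r (Suc i))) (gcr_q j) *s gcr_q j)"
  by pat_completeness auto
termination
  by (relation "Wellfounded.measure (\<lambda>s. case s of Inl (Inl i) \<Rightarrow> 3 * i | Inl (Inr i) \<Rightarrow> 3 * i
       | Inr (Inl i) \<Rightarrow> 3 * i + 1 | Inr (Inr i) \<Rightarrow> 3 * i + 2)") auto

definition gcr_defined :: "nat \<Rightarrow> bool" where
  "gcr_defined i \<longleftrightarrow> (\<forall>j<i. hinner H (gcr_q j) (gcr_q j) \<noteq> 0)"

(* With truncated subtraction, Suc i - k is max(0, i - k + 1). *)
function orthomin_x :: "nat \<Rightarrow> nat \<Rightarrow> complex^'n" and orthomin_r :: "nat \<Rightarrow> nat \<Rightarrow> complex^'n"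
  and orthomin_p :: "nat \<Rightarrow> nat \<Rightarrow> complex^'n" and orthomin_q :: "nat \<Rightarrow> nat \<Rightarrow> complex^'n" where
  "orthomin_x k 0 = x0"
| "orthomin_x k (Suc i) = orthomin_x k i
     + hcoeff H (orthomin_r k i) (orthomin_q k i) *s orthomin_p k i"
| "orthomin_r k 0 = b - A *v x0"
| "orthomin_r k (Suc i) = orthomin_r k i
     - hcoeff H (orthomin_r k i) (orthomin_q k i) *s orthomin_q k i"
| "orthomin_p k 0 = H *v orthomin_r k 0"
| "orthomin_p k (Suc i) = H *v orthomin_r k (Suc i)
     - (\<Sum>j\<in>{Suc i - k..i}.
          hcoeff H (A *v (H *v orthomin_r k (Suc i))) (orthomin_q k j) *s orthomin_p k j)"
| "orthomin_q k i = A *v orthomin_p k i"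
  by pat_completeness auto
termination
  by (relation "Wellfounded.measure (\<lambda>s. case s of Inl (Inl (k, i)) \<Rightarrow> 3 * i | Inl (Inr (k, i)) \<Rightarrow> 3 * i
       | Inr (Inl (k, i)) \<Rightarrow> 3 * i + 1 | Inr (Inr (k, i)) \<Rightarrow> 3 * i + 2)") auto

definition orthomin_defined :: "nat \<Rightarrow> nat \<Rightarrow> bool" where
  "orthomin_defined k i \<longleftrightarrow> (\<forall>j<i. hinner H (orthomin_q k j) (orthomin_q k j) \<noteq> 0)"

fun mr_x :: "nat \<Rightarrow> complex^'n" and mr_r :: "nat \<Rightarrow> complex^'n"
  and mr_p :: "nat \<Rightarrow> complex^'n" and mr_q :: "nat \<Rightarrow> complex^'n" where
  "mr_x 0 = x0"
| "mr_x (Suc i) = mr_x i + hcoeff H (mr_r i) (mr_q i) *s mr_p i"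
| "mr_r 0 = b - A *v x0"
| "mr_r (Suc i) = mr_r i - hcoeff H (mr_r i) (mr_q i) *s mr_q i"
| "mr_p i = H *v mr_r i"
| "mr_q i = A *v mr_p i"

definition mr_defined :: "nat \<Rightarrow> bool" where
  "mr_defined i \<longleftrightarrow> (\<forall>j<i. hinner H (mr_q j) (mr_q j) \<noteq> 0)"

end

context
  fixes K :: "complex set" and A H :: "complex^'n^'n" and b x0 :: "complex^'n"
begin

definition krylov_affine :: "nat \<Rightarrow> (complex^'n) set" where
  "krylov_affine i =
     {x0 + (\<Sum>j<i. c j *s (((\<lambda>v. (H ** A) *v v) ^^ j) (H *v (b - A *v x0)))) | c. \<forall>j. c j \<in> K}"

definition gmres_x :: "nat \<Rightarrow> complex^'n" where
  "gmres_x i = (THE x. x \<in> krylov_affine i \<and>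
     (\<forall>y\<in>krylov_affine i. hnorm H (b - A *v x) \<le> hnorm H (b - A *v y)))"

definition gmres_r :: "nat \<Rightarrow> complex^'n" where
  "gmres_r i = b - A *v gmres_x i"

end

(* Restarting: S y i is the i-th iterate of a method with initial guess y, and cycle_start S m x0 c
   is the initial guess of cycle c (counted from 0) for cycles of m iterations each. The overall
   i-th iterate is iterate number i mod m of cycle i div m. *)
primrec cycle_start ::
    "(complex^'n \<Rightarrow> nat \<Rightarrow> complex^'n) \<Rightarrow> nat \<Rightarrow> complex^'n \<Rightarrow> nat \<Rightarrow> complex^'n" where
  "cycle_start S m x0 0 = x0"
| "cycle_start S m x0 (Suc c) = S (cycle_start S m x0 c) m"

context
  fixes K :: "complex set" and A H :: "complex^'n^'n" and b x0 :: "complex^'n" and k :: nat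
begin

definition gcr_restart_x :: "nat \<Rightarrow> complex^'n" where
  "gcr_restart_x i =
     gcr_x A H b (cycle_start (gcr_x A H b) (k + 1) x0 (i div (k + 1))) (i mod (k + 1))"

definition gcr_restart_r :: "nat \<Rightarrow> complex^'n" where
  "gcr_restart_r i =
     gcr_r A H b (cycle_start (gcr_x A H b) (k + 1) x0 (i div (k + 1))) (i mod (k + 1))"

definition gcr_restart_defined :: "nat \<Rightarrow> bool" where
  "gcr_restart_defined i \<longleftrightarrow>
     (\<forall>c < i div (k + 1). gcr_defined A H b (cycle_start (gcr_x A H b) (k + 1) x0 c) (k + 1)) \<and>
     gcr_defined A H b (cycle_start (gcr_x A H b) (k + 1) x0 (i div (k + 1))) (i mod (k + 1))"

definition gmres_restart_x :: "nat \<Rightarrow> complex^'n" where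
  "gmres_restart_x i =
     gmres_x K A H b (cycle_start (gmres_x K A H b) (k + 1) x0 (i div (k + 1))) (i mod (k + 1))"

definition gmres_restart_r :: "nat \<Rightarrow> complex^'n" where
  "gmres_restart_r i = b - A *v gmres_restart_x i"

end

(* The recursively updated residuals are the true ones. *)

lemma gcr_q_eq: "gcr_q A H b x0 i = A *v gcr_p A H b x0 i"
proof (induction i rule: less_induct)
  case (less i)
  show ?case
  proof (cases i)
    case (Suc m)
    have "gcr_q A H b x0 j = A *v gcr_p A H b x0 j" if "j \<in> {0..m}" for j
      using less Suc that by auto
    then show ?thesis
      unfolding Suc
      by (auto simp: matrix_vector_mult_diff_distrib vec.linear_sum[OF matrix_vector_mul_linear_gen]
            vector_scalar_commute intro!: sum.cong)
  qed simp
qed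

lemma gcr_r_eq: "gcr_r A H b x0 i = b - A *v gcr_x A H b x0 i"
  by (induction i) (simp_all add: gcr_q_eq algebra_simps vector_scalar_commute)

lemma orthomin_r_eq: "orthomin_r A H b x0 k i = b - A *v orthomin_x A H b x0 k i"
  by (induction i) (simp_all add: algebra_simps vector_scalar_commute)

lemma mr_r_eq: "mr_r A H b x0 i = b - A *v mr_x A H b x0 i"
  by (induction i) (simp_all add: algebra_simps vector_scalar_commute)

lemma gcr_restart_r_eq: "gcr_restart_r A H b x0 k i = b - A *v gcr_restart_x A H b x0 k i"
  by (simp add: gcr_restart_r_def gcr_restart_x_def gcr_r_eq)

end

theory Submission
  imports Defs
begin

text \<open>Write \<open>M\<close> and \<open>N\<close> for the Hermitian and skew-Hermitian parts of \<open>A\<close>. Let \<open>r\<close> be a nonzero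
  residual, \<open>z = H r\<close> and \<open>a = A z\<close>. Subtracting from \<open>r\<close> its \<open>H\<close>-orthogonal projection on the
  line through \<open>a\<close> multiplies the squared \<open>H\<close>-norm by one minus
  \<open>|<r,a>|^2 / (<r,r> <a,a>)\<close>, so the heart of the matter is a lower bound for this quotient
  (lemma \<open>preconditioned_angle\<close>). Its numerator is at least \<open>(z* M z)^2\<close>, because \<open>z* N z\<close> is
  imaginary. Each factor of its denominator is at most a multiple of \<open>z* M z\<close>:
  \<^item> \<open>lambda_min (H M) <r,r> \<le> z* M z\<close>, a Rayleigh quotient bound;
  \<^item> \<open><a,a> \<le> lambda_max (H M) a* M^-1 a\<close>, again a Rayleigh quotient bound, followed by
    \<open>a* M^-1 a = z* M z + (N z)* M^-1 (N z) \<le> (1 + rho^2) z* M z\<close>, where the cross terms cancel by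
    skewness and \<open>rho\<close> is the spectral radius of \<open>M^-1 N\<close>.

  All three eigenvalue bounds rest on one fact, \<open>hermitian_pencil_max\<close>: the maximum of a quotient
  of two Hermitian forms is attained, and a maximizer solves the generalized eigenvalue problem.

  GCR, Orthomin and MR share a single scheme: the direction \<open>q i\<close> is \<open>A H (r i)\<close> made orthogonal
  to a window of earlier directions, and the windows only move forward. Orthogonalization does not
  change the inner product with the residual and can only shorten the direction, so each step
  reduces the residual at least as much as projecting along \<open>A H (r i)\<close>
  (\<open>truncated_orthogonalization_bound\<close>). For GMRES, the MR iterates lie in the same Krylov spaces,
  so the minimal residual is no larger than theirs. A bound that is geometric in the iteration
  number and holds for every admissible initial guess survives restarting (\<open>restart_bound\<close>).\<close>

section \<open>The Hermitian inner product and adjoints\<close>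

lemma cinner_add_left: "cinner (x + y) z = cinner x z + cinner y z"
  by (simp add: cinner_def algebra_simps sum.distrib)

lemma cinner_diff_left: "cinner (x - y) z = cinner x z - cinner y z"
  by (simp add: cinner_def algebra_simps sum_subtractf)

lemma cinner_scale_left: "cinner (c *s x) y = c * cinner x y"
  by (simp add: cinner_def sum_distrib_left mult.left_commute)

lemma cinner_commute: "cinner y x = cnj (cinner x y)"
  by (simp add: cinner_def cnj_sum mult.commute)

lemma cinner_add_right: "cinner x (y + z) = cinner x y + cinner x z"
  by (simp add: cinner_def algebra_simps sum.distrib)

lemma cinner_diff_right: "cinner x (y - z) = cinner x y - cinner x z"
  by (simp add: cinner_def algebra_simps sum_subtractf)

lemma cinner_minus_left: "cinner (- x) y = - cinner x y"
  by (simp add: cinner_def sum_negf)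

lemma cinner_minus_right: "cinner x (- y) = - cinner x y"
  by (simp add: cinner_def sum_negf)

lemma cinner_scale_right: "cinner x (c *s y) = cnj c * cinner x y"
  by (simp add: cinner_def sum_distrib_left mult.assoc)

lemmas cinner_simps = cinner_add_left cinner_diff_left cinner_scale_left
  cinner_add_right cinner_diff_right cinner_scale_right

lemma cinner_zero [simp]: "cinner 0 y = 0" "cinner x 0 = 0"
  by (simp_all add: cinner_def)

lemma Re_cinner: "Re (cinner x y) = inner x y"
  by (simp add: cinner_def inner_vec_def inner_complex_def algebra_simps)

lemma cinner_matrix_left: "cinner (B *v x) y = cinner x (ctranspose B *v y)"
proof -
  have "cinner (B *v x) y = (\<Sum>i\<in>UNIV. \<Sum>j\<in>UNIV. cnj (y $ i) * (B $ i $ j * x $ j))"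
    by (simp add: cinner_def matrix_vector_mult_def sum_distrib_left)
  also have "\<dots> = (\<Sum>j\<in>UNIV. \<Sum>i\<in>UNIV. cnj (y $ i) * (B $ i $ j * x $ j))"
    by (rule sum.swap)
  also have "\<dots> = cinner x (ctranspose B *v y)"
    by (simp add: cinner_def ctranspose_def matrix_vector_mult_def sum_distrib_left cnj_sum mult_ac)
  finally show ?thesis .
qed

lemma ctranspose_mult: "ctranspose (B ** C) = ctranspose C ** ctranspose B"
  by (simp add: ctranspose_def matrix_matrix_mult_def vec_eq_iff cnj_sum mult.commute)

lemma ctranspose_ctranspose [simp]: "ctranspose (ctranspose B) = B"
  by (simp add: ctranspose_def vec_eq_iff)

lemma ctranspose_minus: "ctranspose (- B) = - ctranspose B"
  by (simp add: ctranspose_def vec_eq_iff)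

lemma minus_matrix_vector_mult: "(- B) *v x = - ((B :: complex^'n^'m) *v x)"
  by (simp add: vec_eq_iff matrix_vector_mult_def sum_negf)

lemma ctranspose_herm_part: "ctranspose (herm_part B) = herm_part B"
  by (simp add: ctranspose_def herm_part_def vec_eq_iff complex_eq_iff field_simps)

lemma ctranspose_skew_part: "ctranspose (skew_part B) = - skew_part B"
  by (simp add: ctranspose_def skew_part_def vec_eq_iff complex_eq_iff field_simps)

lemma herm_plus_skew: "herm_part B + skew_part B = B"
  by (simp add: herm_part_def skew_part_def vec_eq_iff complex_eq_iff field_simps)

section \<open>Eigenvalues and Rayleigh quotients\<close>

text \<open>Applying \<open>B - e\<close> to a vanishing combination removes the eigenvector of \<open>e\<close> and multiplies the other
  coefficients by the nonzero factors \<open>c - e\<close>, which is the induction step.\<close>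

lemma eigenvectors_independent:
  fixes B :: "complex^'n^'n"
  assumes "finite C" and "\<And>c. c \<in> C \<Longrightarrow> v c \<noteq> 0 \<and> B *v v c = c *s v c"
    and "(\<Sum>c\<in>C. a c *s v c) = 0" and "c \<in> C"
  shows "a c = 0"
  using assms
proof (induction C arbitrary: a c rule: finite_induct)
  case (insert e C)
  let ?u = "\<Sum>c\<in>C. a c *s v c"
  have e: "v e \<noteq> 0" "B *v v e = e *s v e"
    using insert.prems(1) by auto
  have sum0: "a e *s v e + ?u = 0"
    using insert.prems(2) insert.hyps by simp
  have "B *v ?u = (\<Sum>c\<in>C. a c *s (B *v v c))"
    by (simp add: vec.linear_sum[OF matrix_vector_mul_linear_gen] vector_scalar_commute)
  also have "\<dots> = (\<Sum>c\<in>C. (a c * c) *s v c)"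
    using insert.prems(1) by (intro sum.cong) auto
  finally have Bu: "B *v ?u = (\<Sum>c\<in>C. (a c * c) *s v c)" .
  have u: "?u = - (a e *s v e)"
    using sum0 by (simp add: eq_neg_iff_add_eq_0 add.commute)
  have "(\<Sum>c\<in>C. (a c * (c - e)) *s v c) = B *v ?u - e *s ?u"
    unfolding Bu by (simp add: vec.scale_sum_right sum_subtractf[symmetric] algebra_simps
        vec.scale_left_diff_distrib)
  also have "\<dots> = 0"
    unfolding u vector_scalar_commute vec.neg e(2) by (simp add: vector_scalar_commute e(2) mult.commute)
  finally have "a c * (c - e) = 0" if "c \<in> C" for c
    using insert.IH[of "\<lambda>c. a c * (c - e)"] insert.prems(1) that by blast
  then have a0: "a c = 0" if "c \<in> C" for c
    using that insert.hyps by fastforce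
  then have "a e *s v e = 0"
    using sum0 by (simp add: vec_eq_iff)
  then have "a e = 0"
    using e(1) by simp
  then show ?case
    using a0 insert.prems(3) by auto
qed simp

text \<open>The extreme eigenvalues and the spectral radius are a \<^const>\<open>Min\<close> or a \<^const>\<open>Max\<close> of an
  image of the spectrum, which bounds the members of that image only when it is finite.\<close>

lemma finite_eigvals: "finite (eigvals (B :: complex^'n^'n))"
proof (rule ccontr)
  assume "infinite (eigvals B)"
  then obtain C where C: "C \<subseteq> eigvals B" "finite C" "card C = Suc CARD('n)"
    using infinite_arbitrarily_large by blast
  then have "\<forall>c\<in>C. \<exists>v. v \<noteq> 0 \<and> B *v v = c *s v"
    by (auto simp: eigvals_def)
  then obtain v where v: "\<And>c. c \<in> C \<Longrightarrow> v c \<noteq> 0 \<and> B *v v c = c *s v c"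
    by metis
  have inj: "inj_on v C"
    using v by (intro inj_onI) (metis vector_mul_rcancel)
  have "vec.independent (v ` C)"
  proof (subst vec.dependent_finite)
    have "u (v c) = 0" if "(\<Sum>c\<in>C. u (v c) *s v c) = 0" "c \<in> C" for u c
      using eigenvectors_independent[OF C(2) v that] .
    then show "\<not> (\<exists>u. (\<exists>w\<in>v ` C. u w \<noteq> 0) \<and> (\<Sum>w\<in>v ` C. u w *s w) = 0)"
      unfolding sum.reindex[OF inj] comp_def by blast
  qed (use C in simp)
  then have "card (v ` C) \<le> CARD('n)"
    using vec.independent_card_le_dim[OF subset_UNIV] by (simp add: card_cart_basis)
  then show False
    using C inj by (simp add: card_image)
qed

lemma continuous_on_matrix_vector_mult [continuous_intros]:
  "continuous_on S f \<Longrightarrow> continuous_on S (\<lambda>x. (B :: complex^'n^'m) *v f x)"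
  unfolding matrix_vector_mult_def
  by (intro continuous_on_vec_lambda continuous_intros)

lemma of_real_scale: "of_real c *s (x :: complex^'n) = c *\<^sub>R x"
  by (simp add: vec_eq_iff complex_eq_iff)

text \<open>Moving from \<open>v\<close> a short way in the direction \<open>- P v\<close> would make the form negative if \<open>P v\<close> were not
  zero: the first-order decrease \<open>2 t |P v|^2\<close> beats the second-order term.\<close>

lemma psd_null_vector:
  assumes herm: "ctranspose P = P" and psd: "\<And>x. 0 \<le> Re (cinner (P *v x) x)"
    and "Re (cinner (P *v v) v) = 0"
  shows "P *v v = 0"
proof (rule ccontr)
  define w where "w = P *v v"
  define a where "a = Re (cinner w w)"
  define c where "c = Re (cinner (P *v w) w)"
  \<comment> \<open>Along the step \<open>t\<close> the form takes the value \<open>t (t c - 2 a)\<close>; this choice gives \<open>t c \<le> a < 2 a\<close>.\<close>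
  define t where "t = a / (c + 1)"
  assume "P *v v \<noteq> 0"
  then have a: "a > 0"
    by (simp add: a_def Re_cinner w_def)
  have c: "c \<ge> 0"
    unfolding c_def by (rule psd)
  have "cinner (P *v w) v = cinner w w"
    by (simp add: cinner_matrix_left herm w_def)
  then have "Re (cinner (P *v (v - of_real t *s w)) (v - of_real t *s w)) = t * (t * c - 2 * a)"
    using assms(3)
    by (simp add: matrix_vector_mult_diff_distrib vector_scalar_commute cinner_simps w_def[symmetric]
        a_def c_def algebra_simps)
  moreover have "t > 0"
    using a c by (simp add: t_def)
  moreover have "t * c \<le> a"
    using a c by (simp add: t_def field_simps)
  ultimately show False
    using psd[of "v - of_real t *s w"] a by (simp add: zero_le_mult_iff)
qed

text \<open>By homogeneity and compactness of the unit sphere the quotient of the two forms has a largest value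
  \<open>\<mu>\<close>, attained at some \<open>v\<close>. Then \<open>\<mu> G - S\<close> is positive semidefinite and its form vanishes at \<open>v\<close>,
  so it annihilates \<open>v\<close>.\<close>

lemma hermitian_pencil_max:
  fixes S G :: "complex^'n^'n"
  assumes S: "ctranspose S = S" and G: "ctranspose G = G"
    and pos: "\<And>x. x \<noteq> 0 \<Longrightarrow> Re (cinner (G *v x) x) > 0"
  obtains \<mu> v where "v \<noteq> 0" and "S *v v = of_real \<mu> *s (G *v v)"
    and "\<And>x. Re (cinner (S *v x) x) \<le> \<mu> * Re (cinner (G *v x) x)"
proof -
  let ?f = "\<lambda>x. inner (S *v x) x / inner (G *v x) x"
  have pos': "x \<noteq> 0 \<Longrightarrow> inner (G *v x) x > 0" for x
    using pos[of x] by (simp add: Re_cinner)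
  have "inner (G *v x) x \<noteq> 0" if "x \<in> sphere 0 1" for x
    using pos'[of x] that by (cases "x = 0") auto
  then have "continuous_on (sphere 0 1) ?f"
    by (intro continuous_intros) auto
  moreover have "axis undefined 1 \<in> sphere (0 :: complex^'n) 1"
    by simp
  ultimately obtain v where v: "v \<in> sphere 0 1" "\<And>x. x \<in> sphere 0 1 \<Longrightarrow> ?f x \<le> ?f v"
    using continuous_attains_sup[OF compact_sphere, of 0 1 ?f] by blast
  define \<mu> where "\<mu> = ?f v"
  have v0: "v \<noteq> 0"
    using v(1) by auto
  have max: "Re (cinner (S *v x) x) \<le> \<mu> * Re (cinner (G *v x) x)" for x
  proof (cases "x = 0")
    case False
    let ?y = "(1 / norm x) *\<^sub>R x"
    have scale: "T *v ?y = (1 / norm x) *\<^sub>R (T *v x)" for T :: "complex^'n^'n"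
      by (simp only: of_real_scale[symmetric] vector_scalar_commute)
    have "?y \<in> sphere 0 1"
      using False by simp
    then have "?f ?y \<le> \<mu>"
      unfolding \<mu>_def by (rule v(2))
    moreover have "?f ?y = ?f x"
      unfolding scale using False by simp
    ultimately have "?f x \<le> \<mu>"
      by metis
    then show ?thesis
      using pos'[OF False] by (simp add: Re_cinner field_simps)
  qed simp
  define P where "P = (\<chi> i j. of_real \<mu> * G $ i $ j - S $ i $ j)"
  have P: "P *v x = of_real \<mu> *s (G *v x) - S *v x" for x
    by (simp add: P_def vec_eq_iff matrix_vector_mult_def algebra_simps sum_subtractf sum_distrib_left)
  have "cnj (G $ j $ i) = G $ i $ j" "cnj (S $ j $ i) = S $ i $ j" for i j
    using arg_cong[OF G, of "\<lambda>X. X $ i $ j"] arg_cong[OF S, of "\<lambda>X. X $ i $ j"]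
    by (simp_all add: ctranspose_def)
  then have "ctranspose P = P"
    by (simp add: P_def ctranspose_def vec_eq_iff)
  moreover have "Re (cinner (P *v v) v) = 0"
    using pos'[OF v0] by (simp add: P cinner_simps \<mu>_def Re_cinner)
  ultimately have "P *v v = 0"
    using max by (intro psd_null_vector) (auto simp: P cinner_simps)
  then show ?thesis
    using that[of v \<mu>] v0 max by (simp add: P)
qed

section \<open>Positive definite matrices\<close>

text \<open>Positivity is required on all complex vectors, also when the scalar field of the problem is real:
  the eigenvectors that the Rayleigh quotient bounds produce are complex in general.\<close>

definition pos_def :: "complex^'n^'n \<Rightarrow> bool" where
  "pos_def B \<longleftrightarrow> (\<forall>x. x \<noteq> 0 \<longrightarrow> Re (cinner (B *v x) x) > 0)"

text \<open>For a real matrix, the real part of the form at \<open>u + \<i> w\<close> is the sum of the forms at the real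
  vectors \<open>u\<close> and \<open>w\<close>.\<close>

lemma pos_def_over:
  fixes B :: "complex^'n^'n"
  assumes K: "K = \<real> \<or> K = UNIV" and B: "mat_over K B" and "hpd K B"
  shows "pos_def B"
proof (cases "K = UNIV")
  case True
  then show ?thesis
    using assms by (auto simp: hpd_def pos_def_def vec_over_def)
next
  case False
  then have K: "K = \<real>"
    using K by simp
  have Bij: "Im (B $ i $ j) = 0" for i j
    using B unfolding K mat_over_def by (simp add: complex_is_Real_iff)
  have ge: "Re (cinner (B *v y) y) > 0" if "\<And>i. Im (y $ i) = 0" "y \<noteq> 0" for y
    using assms(3) that unfolding K hpd_def vec_over_def by (simp add: complex_is_Real_iff)
  have ge0: "Re (cinner (B *v y) y) \<ge> 0" if "\<And>i. Im (y $ i) = 0" for y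
    using ge[OF that] by (cases "y = 0") (auto intro: less_imp_le)
  show ?thesis
    unfolding pos_def_def
  proof (intro allI impI)
    fix x :: "complex^'n"
    assume x: "x \<noteq> 0"
    define u w :: "complex^'n" where "u = (\<chi> i. of_real (Re (x $ i)))" and "w = (\<chi> i. of_real (Im (x $ i)))"
    have "Re (cinner (B *v x) x) = Re (cinner (B *v u) u) + Re (cinner (B *v w) w)"
      by (simp add: Re_cinner inner_vec_def matrix_vector_mult_def inner_complex_def u_def w_def Bij
          sum.distrib[symmetric] algebra_simps)
    moreover have "u \<noteq> 0 \<or> w \<noteq> 0"
      using x by (auto simp: u_def w_def vec_eq_iff complex_eq_iff)
    ultimately show "Re (cinner (B *v x) x) > 0"
      using ge[of u] ge[of w] ge0[of u] ge0[of w] by (auto simp: u_def w_def add_pos_nonneg add_nonneg_pos)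
  qed
qed

lemma pos_def_ge0: "pos_def B \<Longrightarrow> Re (cinner (B *v x) x) \<ge> 0"
  by (cases "x = 0") (auto simp: pos_def_def intro: less_imp_le)

lemma pos_def_inj:
  assumes "pos_def B" "B *v x = B *v y"
  shows "x = y"
proof -
  have "B *v (x - y) = 0"
    using assms(2) by (simp add: matrix_vector_mult_diff_distrib)
  then show ?thesis
    using assms(1) unfolding pos_def_def
    by (metis cinner_zero(1) less_irrefl right_minus_eq zero_complex.sel(1))
qed

lemma pos_def_inv:
  assumes "pos_def (B :: complex^'n^'n)"
  shows "B ** matrix_inv B = mat 1"
proof -
  have "inj ((*v) B)"
    using pos_def_inj[OF assms] by (auto intro: injI)
  then have "invertible B"
    by (simp add: invertible_left_inverse matrix_left_invertible_injective)
  then show ?thesis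
    unfolding invertible_def matrix_inv_def by (rule someI2_ex) simp
qed

lemma lambda_min_le:
  assumes "c \<in> eigvals B" shows "lambda_min B \<le> Re c"
  using assms finite_eigvals[of B] by (auto simp: lambda_min_def)

lemma lambda_max_ge:
  assumes "c \<in> eigvals B" shows "Re c \<le> lambda_max B"
  using assms finite_eigvals[of B] by (auto simp: lambda_max_def)

lemma spec_radius_ge:
  assumes "c \<in> eigvals B" shows "cmod c \<le> spec_radius B"
  using assms finite_eigvals[of B] by (auto simp: spec_radius_def)

section \<open>Eigenvalue bounds for the preconditioned problem\<close>

locale weighted_problem =
  fixes A H :: "complex^'n^'n"
  assumes H_herm: "ctranspose H = H" and H_pos: "pos_def H" and M_pos: "pos_def (herm_part A)"
begin

abbreviation "M \<equiv> herm_part A"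
abbreviation "N \<equiv> skew_part A"

text \<open>The smallest value of the quotient is the largest one for the negated form. A maximizer \<open>v\<close> makes
  \<open>H v\<close> an eigenvector of \<open>H M\<close>.\<close>

lemma lambda_min_bound:
  "lambda_min (H ** M) * Re (cinner (H *v x) x) \<le> Re (cinner (M *v (H *v x)) (H *v x))"
proof -
  define S where "S = - (H ** M ** H)"
  have S: "S *v y = - (H *v (M *v (H *v y)))" for y
    by (simp add: S_def minus_matrix_vector_mult matrix_vector_mul_assoc matrix_mul_assoc)
  have "ctranspose S = S"
    unfolding S_def
    by (simp add: ctranspose_minus ctranspose_mult ctranspose_herm_part H_herm matrix_mul_assoc)
  obtain \<mu> v where v: "v \<noteq> 0" "S *v v = of_real \<mu> *s (H *v v)"
    and max: "\<And>x. Re (cinner (S *v x) x) \<le> \<mu> * Re (cinner (H *v x) x)"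
    using hermitian_pencil_max[of S H] \<open>ctranspose S = S\<close> H_herm H_pos unfolding pos_def_def by metis
  have "H *v v \<noteq> 0"
    using pos_def_inj[OF H_pos, of v 0] v by auto
  moreover have "(H ** M) *v (H *v v) = of_real (- \<mu>) *s (H *v v)"
    using v(2) by (simp add: S matrix_vector_mul_assoc[symmetric] minus_equation_iff)
  ultimately have "of_real (- \<mu>) \<in> eigvals (H ** M)"
    unfolding eigvals_def by blast
  then have "lambda_min (H ** M) \<le> - \<mu>"
    using lambda_min_le by fastforce
  then have "lambda_min (H ** M) * Re (cinner (H *v x) x) \<le> - \<mu> * Re (cinner (H *v x) x)"
    using pos_def_ge0[OF H_pos] by (intro mult_right_mono)
  also have "\<dots> \<le> - Re (cinner (S *v x) x)"
    using max[of x] by simp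
  also have "\<dots> = Re (cinner (M *v (H *v x)) (H *v x))"
    unfolding S by (simp add: cinner_minus_left cinner_matrix_left[of H] H_herm)
  finally show ?thesis .
qed

text \<open>With \<open>q = M y\<close> this compares \<open>q* H q\<close> with \<open>q* M^-1 q\<close>; the parametrization by \<open>y\<close> turns the
  generalized eigenvalue problem into \<open>H M v = \<mu> v\<close>, up to the injective factor \<open>M\<close>.\<close>

lemma lambda_max_bound:
  "Re (cinner (H *v (M *v y)) (M *v y)) \<le> lambda_max (H ** M) * Re (cinner (M *v y) y)"
proof -
  define S where "S = M ** H ** M"
  have S: "S *v y = M *v (H *v (M *v y))" for y
    by (simp add: S_def matrix_vector_mul_assoc matrix_mul_assoc)
  have "ctranspose S = S"
    unfolding S_def by (simp add: ctranspose_mult ctranspose_herm_part H_herm matrix_mul_assoc)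
  then obtain \<mu> v where v: "v \<noteq> 0" "S *v v = of_real \<mu> *s (M *v v)"
    and max: "\<And>x. Re (cinner (S *v x) x) \<le> \<mu> * Re (cinner (M *v x) x)"
    using hermitian_pencil_max[of S M] ctranspose_herm_part M_pos unfolding pos_def_def by metis
  have "M *v (H *v (M *v v)) = M *v (of_real \<mu> *s v)"
    using v(2) by (simp add: S vector_scalar_commute)
  then have "(H ** M) *v v = of_real \<mu> *s v"
    using pos_def_inj[OF M_pos] by (simp add: matrix_vector_mul_assoc)
  then have "of_real \<mu> \<in> eigvals (H ** M)"
    using v(1) unfolding eigvals_def by blast
  then have "\<mu> \<le> lambda_max (H ** M)"
    using lambda_max_ge by fastforce
  then have "\<mu> * Re (cinner (M *v y) y) \<le> lambda_max (H ** M) * Re (cinner (M *v y) y)"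
    using pos_def_ge0[OF M_pos] by (intro mult_right_mono)
  moreover have "cinner (S *v y) y = cinner (H *v (M *v y)) (M *v y)"
    unfolding S by (simp add: cinner_matrix_left[of M] ctranspose_herm_part)
  ultimately show ?thesis
    using max[of y] by simp
qed

abbreviation "B \<equiv> matrix_inv M ** N"

lemma M_B: "M *v (B *v z) = N *v z"
  by (simp add: matrix_vector_mul_assoc matrix_mul_assoc pos_def_inv[OF M_pos])

text \<open>\<open>B\<close> is skew-adjoint for the inner product of \<open>M\<close>, so the largest value \<open>\<mu>\<close> of the quotient is an
  eigenvalue of \<open>- B^2\<close>. It is nonnegative, and \<open>B^2 + \<mu> = (B - s) (B + s)\<close> with \<open>s = \<i> sqrt \<mu>\<close>, so
  \<open>s\<close> or \<open>- s\<close> is an eigenvalue of \<open>B\<close>, of modulus \<open>sqrt \<mu>\<close>.\<close>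

lemma spec_radius_bound:
  "Re (cinner (M *v (B *v z)) (B *v z)) \<le> (spec_radius B)\<^sup>2 * Re (cinner (M *v z) z)"
proof -
  define S where "S = ctranspose B ** (M ** B)"
  have "ctranspose S = S"
    unfolding S_def ctranspose_mult[of "ctranspose B"] ctranspose_mult[of M]
    by (simp add: ctranspose_herm_part matrix_mul_assoc)
  then obtain \<mu> v where v: "v \<noteq> 0" "S *v v = of_real \<mu> *s (M *v v)"
    and max: "\<And>x. Re (cinner (S *v x) x) \<le> \<mu> * Re (cinner (M *v x) x)"
    using hermitian_pencil_max[of S M] ctranspose_herm_part M_pos unfolding pos_def_def by metis
  have SS: "cinner (S *v x) x = cinner (M *v (B *v x)) (B *v x)" for x
    by (simp add: S_def matrix_vector_mul_assoc[symmetric] cinner_matrix_left[of "ctranspose B"])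
  have MB: "M ** B = N"
    by (simp add: matrix_mul_assoc pos_def_inv[OF M_pos])
  have "ctranspose B ** M = ctranspose (M ** B)"
    by (simp only: ctranspose_mult[of M] ctranspose_herm_part)
  then have "ctranspose B ** M = - N"
    unfolding MB ctranspose_skew_part .
  then have "S = - N ** B"
    unfolding S_def matrix_mul_assoc by simp
  have "S *v v = - (N *v (B *v v))"
    unfolding \<open>S = - N ** B\<close> by (simp only: matrix_vector_mul_assoc[symmetric] minus_matrix_vector_mult)
  then have "N *v (B *v v) = of_real (- \<mu>) *s (M *v v)"
    using v(2) by (simp add: minus_equation_iff)
  then have "M *v (B *v (B *v v)) = M *v (of_real (- \<mu>) *s v)"
    unfolding M_B by (simp only: vector_scalar_commute)
  then have BB: "B *v (B *v v) = of_real (- \<mu>) *s v"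
    by (rule pos_def_inj[OF M_pos])
  have "0 \<le> \<mu> * Re (cinner (M *v v) v)"
    using max[of v] pos_def_ge0[OF M_pos, of "B *v v"] unfolding SS by linarith
  then have \<mu>: "\<mu> \<ge> 0"
    using v(1) M_pos by (auto simp: pos_def_def zero_le_mult_iff dest: spec[of _ v])
  define s where "s = \<i> * of_real (sqrt \<mu>)"
  have s2: "s * (s * c) = - of_real \<mu> * c" for c
    using \<mu> by (simp add: s_def complex_eq_iff)
  have "sqrt \<mu> \<le> spec_radius B"
  proof (cases "B *v v + s *s v = 0")
    case True
    then have "B *v v = (- s) *s v"
      by (simp add: eq_neg_iff_add_eq_0)
    then have "- s \<in> eigvals B"
      using v(1) unfolding eigvals_def by blast
    then show ?thesis
      using spec_radius_ge \<mu> by (fastforce simp: s_def norm_mult)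
  next
    case False
    have "B *v (B *v v + s *s v) = s *s (B *v v + s *s v)"
      unfolding matrix_vector_right_distrib vector_scalar_commute BB
      by (simp add: vec_eq_iff s2 algebra_simps)
    then have "s \<in> eigvals B"
      using False unfolding eigvals_def by blast
    then show ?thesis
      using spec_radius_ge \<mu> by (fastforce simp: s_def norm_mult)
  qed
  then have "\<mu> \<le> (spec_radius B)\<^sup>2"
    using \<mu> by (metis power_mono real_sqrt_ge_zero real_sqrt_pow2)
  then have "\<mu> * Re (cinner (M *v z) z) \<le> (spec_radius B)\<^sup>2 * Re (cinner (M *v z) z)"
    using pos_def_ge0[OF M_pos] by (intro mult_right_mono)
  then show ?thesis
    using max[of z] unfolding SS by linarith
qed

lemma Re_cinner_A: "Re (cinner (A *v z) z) = Re (cinner (M *v z) z)"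
proof -
  have "cinner (N *v z) z = cinner z (- (N *v z))"
    by (simp only: cinner_matrix_left ctranspose_skew_part minus_matrix_vector_mult)
  also have "\<dots> = - cnj (cinner (N *v z) z)"
    unfolding cinner_minus_right by (subst cinner_commute) simp
  finally have "cinner (N *v z) z = - cnj (cinner (N *v z) z)" .
  then have "Re (cinner (N *v z) z) = 0"
    by (auto dest: arg_cong[where f = Re])
  moreover have "A *v z = M *v z + N *v z"
    by (metis herm_plus_skew matrix_vector_mult_add_rdistrib)
  ultimately show ?thesis
    by (simp add: cinner_simps)
qed

end

section \<open>One projection step\<close>

lemma hinner_simps:
  "hinner H (x + y) z = hinner H x z + hinner H y z"
  "hinner H (x - y) z = hinner H x z - hinner H y z"
  "hinner H (c *s x) z = c * hinner H x z"
  "hinner H x (y + z) = hinner H x y + hinner H x z"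
  "hinner H x (y - z) = hinner H x y - hinner H x z"
  "hinner H x (c *s y) = cnj c * hinner H x y"
  by (simp_all add: hinner_def matrix_vector_right_distrib matrix_vector_mult_diff_distrib
      vector_scalar_commute cinner_simps)

lemma hinner_zero [simp]: "hinner H 0 y = 0" "hinner H x 0 = 0"
  by (simp_all add: hinner_def)

lemma hinner_sum_left: "hinner H (\<Sum>j\<in>J. f j) y = (\<Sum>j\<in>J. hinner H (f j) y)"
  by (induction J rule: infinite_finite_induct) (simp_all add: hinner_simps)

context weighted_problem
begin

lemma hinner_commute: "hinner H y x = cnj (hinner H x y)"
  unfolding hinner_def by (subst cinner_commute) (simp add: cinner_matrix_left[of H y] H_herm)

lemma hinner_self_real: "hinner H x x = of_real (Re (hinner H x x))"
  using hinner_commute[of x x] by (simp add: complex_eq_iff)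

lemma hinner_pos: "x \<noteq> 0 \<Longrightarrow> Re (hinner H x x) > 0"
  using H_pos by (simp add: hinner_def pos_def_def)

lemma hinner_ge0: "Re (hinner H x x) \<ge> 0"
  using pos_def_ge0[OF H_pos] by (simp add: hinner_def)

lemma hinner_residual_self: "hinner H (u - hcoeff H u q *s q) q = 0"
proof (cases "q = 0")
  case False
  then have "hinner H q q \<noteq> 0"
    using hinner_pos by fastforce
  then show ?thesis
    by (simp add: hinner_simps hcoeff_def)
qed simp

lemma hinner_minimal_step:
  assumes "q \<noteq> 0"
  shows "Re (hinner H (r - hcoeff H r q *s q) (r - hcoeff H r q *s q))
       = Re (hinner H r r) - (cmod (hinner H r q))\<^sup>2 / Re (hinner H q q)"
proof -
  have "hinner H (r - hcoeff H r q *s q) (r - hcoeff H r q *s q)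
      = hinner H (r - hcoeff H r q *s q) r"
    by (simp only: hinner_simps(5,6) hinner_residual_self) simp
  also have "\<dots> = hinner H r r - hinner H r q * cnj (hinner H r q) / hinner H q q"
    by (simp add: hinner_simps hcoeff_def hinner_commute[of q r])
  also have "hinner H r q * cnj (hinner H r q) = of_real ((cmod (hinner H r q))\<^sup>2)"
    by (simp only: complex_norm_square)
  finally have "hinner H (r - hcoeff H r q *s q) (r - hcoeff H r q *s q)
      = hinner H r r - of_real ((cmod (hinner H r q))\<^sup>2) / hinner H q q" .
  moreover obtain d where "hinner H q q = of_real d"
    using hinner_self_real by blast
  ultimately show ?thesis
    by simp
qed

text \<open>This is \<open>1 - rate A H\<close>.\<close>

abbreviation "kappa \<equiv> lambda_min (H ** M) / lambda_max (H ** M) * (1 / (1 + (spec_radius B)\<^sup>2))"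

text \<open>A lower bound for the squared cosine of the \<open>H\<close>-angle between \<open>r\<close> and \<open>A H r\<close>. Writing \<open>a = M y\<close>
  with \<open>y = z + B z\<close> makes the upper bound for \<open>a* H a\<close> applicable, and
  \<open>y* M y = z* M z + (B z)* M (B z)\<close> since \<open>B\<close> is skew-adjoint for \<open>M\<close>.\<close>

lemma preconditioned_angle:
  assumes "r \<noteq> 0"
  defines "a \<equiv> A *v (H *v r)"
  shows "hinner H r a \<noteq> 0"
    and "kappa * Re (hinner H r r) * Re (hinner H a a) \<le> (cmod (hinner H r a))\<^sup>2"
proof -
  define z where "z = H *v r"
  define y where "y = z + B *v z"
  define m where "m = Re (cinner (M *v z) z)"
  let ?l = "lambda_min (H ** M)" and ?L = "lambda_max (H ** M)" and ?R = "1 + (spec_radius B)\<^sup>2"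
  have z0: "z \<noteq> 0"
    using pos_def_inj[OF H_pos, of r 0] assms(1) by (auto simp: z_def)
  have m: "m > 0"
    using M_pos z0 by (simp add: m_def pos_def_def)
  have "hinner H a r = cinner (A *v z) z"
    by (simp add: hinner_def a_def z_def cinner_matrix_left[of H] H_herm)
  then have "Re (hinner H a r) = m"
    using Re_cinner_A by (simp add: m_def)
  then have "Re (hinner H r a) = m"
    by (subst hinner_commute) simp
  then have m_le: "m \<le> cmod (hinner H r a)"
    using complex_Re_le_cmod by metis
  then show nz: "hinner H r a \<noteq> 0"
    using m by auto
  have h: "?l * Re (hinner H r r) \<le> m"
    using lambda_min_bound by (simp add: hinner_def m_def z_def)
  have "a = M *v z + N *v z"
    unfolding a_def z_def[symmetric] by (metis herm_plus_skew matrix_vector_mult_add_rdistrib)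
  then have My: "a = M *v y"
    unfolding y_def matrix_vector_right_distrib M_B .
  have cross: "cinner (N *v z) z + cinner (M *v z) (B *v z) = 0"
  proof -
    have "cinner (M *v z) (B *v z) = cinner z (N *v z)"
      unfolding M_B[symmetric] by (simp only: cinner_matrix_left[of M z] ctranspose_herm_part)
    also have "\<dots> = - cinner (N *v z) z"
      by (simp only: cinner_matrix_left ctranspose_skew_part minus_matrix_vector_mult cinner_minus_right minus_minus)
    finally show ?thesis
      by simp
  qed
  have "cinner (M *v y) y = cinner (M *v z) z + cinner (M *v (B *v z)) (B *v z)
      + (cinner (N *v z) z + cinner (M *v z) (B *v z))"
    unfolding y_def matrix_vector_right_distrib cinner_simps M_B by simp
  then have "Re (cinner (M *v y) y) = m + Re (cinner (M *v (B *v z)) (B *v z))"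
    unfolding cross m_def by simp
  also have "\<dots> \<le> ?R * m"
    using spec_radius_bound[of z] by (simp add: m_def algebra_simps)
  finally have y: "Re (cinner (M *v y) y) \<le> ?R * m" .
  have a0: "a \<noteq> 0"
    using nz by auto
  then have y0: "y \<noteq> 0"
    by (auto simp: My)
  have aL: "Re (hinner H a a) \<le> ?L * Re (cinner (M *v y) y)"
    using lambda_max_bound by (simp add: hinner_def My)
  have "Re (cinner (M *v y) y) > 0"
    using M_pos y0 by (simp add: pos_def_def)
  then have L: "?L > 0"
    using less_le_trans[OF hinner_pos[OF a0] aL] zero_less_mult_pos2 by blast
  have R: "?R > 0"
    by (simp add: add_pos_nonneg)
  have "Re (hinner H a a) \<le> ?L * (?R * m)"
    using aL mult_left_mono[OF y, of ?L] L by linarith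
  then have a: "Re (hinner H a a) / (?L * ?R) \<le> m"
    using L R by (simp only: pos_divide_le_eq mult_pos_pos) (simp only: mult_ac)
  have "kappa * Re (hinner H r r) * Re (hinner H a a)
      = (?l * Re (hinner H r r)) * (Re (hinner H a a) / (?L * ?R))"
    by simp
  also have "\<dots> \<le> m * (Re (hinner H a a) / (?L * ?R))"
    using h L R hinner_ge0 by (intro mult_right_mono) auto
  also have "\<dots> \<le> m * m"
    using a m by (intro mult_left_mono) auto
  also have "\<dots> \<le> (cmod (hinner H r a))\<^sup>2"
    using m_le m by (simp add: power2_eq_square mult_mono)
  finally show "kappa * Re (hinner H r r) * Re (hinner H a a) \<le> (cmod (hinner H r a))\<^sup>2" .
qed

text \<open>The gain \<open>|<r,q>|^2 / <q,q>\<close> of a projection step along \<open>q\<close> is at least the gain along \<open>A H r\<close>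
  when the numerator is the same and \<open>q\<close> is not longer.\<close>

lemma step_contraction:
  assumes ra: "hinner H r q = hinner H r (A *v (H *v r))"
    and qa: "Re (hinner H q q) \<le> Re (hinner H (A *v (H *v r)) (A *v (H *v r)))"
  shows "hnorm H (r - hcoeff H r q *s q) \<le> sqrt (rate A H) * hnorm H r"
proof (cases "r = 0")
  case True
  then show ?thesis
    by (simp add: hcoeff_def hnorm_def)
next
  case False
  let ?a = "A *v (H *v r)"
  have "q \<noteq> 0"
    using preconditioned_angle(1)[OF False] ra by auto
  then have q: "Re (hinner H q q) > 0"
    by (rule hinner_pos)
  have "kappa * Re (hinner H r r) \<le> (cmod (hinner H r q))\<^sup>2 / Re (hinner H ?a ?a)"
    using preconditioned_angle(2)[OF False] q qa by (simp add: ra pos_le_divide_eq)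
  also have "\<dots> \<le> (cmod (hinner H r q))\<^sup>2 / Re (hinner H q q)"
    using q qa by (intro divide_left_mono) auto
  finally have "Re (hinner H (r - hcoeff H r q *s q) (r - hcoeff H r q *s q))
      \<le> rate A H * Re (hinner H r r)"
    unfolding hinner_minimal_step[OF \<open>q \<noteq> 0\<close>] by (simp add: rate_def algebra_simps)
  then show ?thesis
    unfolding hnorm_def real_sqrt_mult[symmetric] by (rule real_sqrt_le_mono)
qed

text \<open>A factor by which the norm of a nonzero vector is contracted cannot be negative.\<close>

lemma sqrt_rate_nonneg: "0 \<le> sqrt (rate A H)"
proof -
  define r :: "complex^'n" where "r = axis undefined 1"
  have "hnorm H r > 0"
    using hinner_pos by (simp add: hnorm_def r_def axis_eq_0_iff)
  moreover have "0 \<le> sqrt (rate A H) * hnorm H r"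
    using step_contraction[OF refl order_refl, of r] 
    by (rule order_trans[rotated]) (simp add: hnorm_def hinner_ge0)
  ultimately show ?thesis
    by (simp add: zero_le_mult_iff)
qed

section \<open>GCR, Orthomin and MR\<close>

text \<open>The common scheme: \<open>lo i = 0\<close> gives GCR, \<open>lo i = Suc i - k\<close> gives Orthomin and \<open>lo i = Suc i\<close>, with
  empty windows, gives MR. Since \<open>lo\<close> is nondecreasing, two directions in a window \<open>{lo i..i}\<close> are orthogonal:
  the window of the later one reached back at least as far. Hence \<open>q (Suc i)\<close> and \<open>r (Suc i)\<close> are
  orthogonal to the window, and removing the components along it from \<open>A H (r (Suc i))\<close> keeps the
  inner product with the residual and shortens the vector.\<close>

lemma truncated_orthogonalization_bound:
  fixes r q :: "nat \<Rightarrow> complex^'n" and lo :: "nat \<Rightarrow> nat"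
  assumes r: "\<And>i. r (Suc i) = r i - hcoeff H (r i) (q i) *s q i"
    and q0: "q 0 = A *v (H *v r 0)"
    and q: "\<And>i. q (Suc i) = A *v (H *v r (Suc i))
      - (\<Sum>j\<in>{lo i..i}. hcoeff H (A *v (H *v r (Suc i))) (q j) *s q j)"
    and lo: "\<And>i. lo i \<le> lo (Suc i)"
  shows "hnorm H (r i) \<le> sqrt (rate A H) ^ i * hnorm H (r 0)"
proof -
  have lo_mono: "lo i \<le> lo j" if "i \<le> j" for i j
    using lift_Suc_mono_le[of lo] lo that by blast
  have q_orth: "hinner H (q (Suc i)) (q j) = 0" if "j \<in> {lo i..i}" for i j
    using that
  proof (induction i arbitrary: j rule: less_induct)
    case (less i)
    have other: "hinner H (q l) (q j) = 0" if l: "l \<in> {lo i..i}" "l \<noteq> j" for l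
    proof (cases "j < l")
      case True
      then obtain m where "l = Suc m" "m < i" "j \<le> m"
        using l by (cases l) auto
      then show ?thesis
        using less.IH[of m j] less.prems lo_mono[of m i] by auto
    next
      case False
      then obtain m where "j = Suc m" "m < i" "l \<le> m"
        using l less.prems by (cases j) auto
      then have "hinner H (q j) (q l) = 0"
        using less.IH[of m l] l lo_mono[of m i] by auto
      then show ?thesis
        by (subst hinner_commute) simp
    qed
    define a where "a = A *v (H *v r (Suc i))"
    have "hinner H (\<Sum>l\<in>{lo i..i}. hcoeff H a (q l) *s q l) (q j)
        = (\<Sum>l\<in>{lo i..i}. if l = j then hinner H (hcoeff H a (q j) *s q j) (q j) else 0)"
      unfolding hinner_sum_left using other by (intro sum.cong) (auto simp: hinner_simps(3))
    also have "\<dots> = hinner H (hcoeff H a (q j) *s q j) (q j)"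
      using less.prems by simp
    finally show ?case
      unfolding q a_def[symmetric] using hinner_residual_self[of a "q j"] by (simp add: hinner_simps(2))
  qed
  have r_orth: "hinner H (r (Suc i)) (q j) = 0" if "j \<in> {lo i..i}" for i j
    using that
  proof (induction i)
    case 0
    then show ?case
      using hinner_residual_self by (simp add: r)
  next
    case (Suc i)
    show ?case
    proof (cases "j = Suc i")
      case True
      then show ?thesis
        using hinner_residual_self by (simp add: r[of "Suc i"])
    next
      case False
      then have "j \<in> {lo i..i}"
        using Suc.prems lo[of i] by auto
      then show ?thesis
        using Suc.IH q_orth[of j i] by (simp add: r[of "Suc i"] hinner_simps)
    qed
  qed
  have step: "hnorm H (r (Suc i)) \<le> sqrt (rate A H) * hnorm H (r i)" for i
  proof -
    define a where "a = A *v (H *v r i)"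
    \<comment> \<open>\<open>s\<close> is the component of \<open>a\<close> in the span of the window.\<close>
    obtain s where a: "a = q i + s" and sq: "hinner H s (q i) = 0" and sr: "hinner H s (r i) = 0"
    proof (cases i)
      case 0
      then show ?thesis
        using that[of 0] by (simp add: a_def q0)
    next
      case (Suc m)
      let ?s = "\<Sum>j\<in>{lo m..m}. hcoeff H a (q j) *s q j"
      have "hinner H (q j) (q i) = 0" "hinner H (q j) (r i) = 0" if "j \<in> {lo m..m}" for j
        using q_orth[OF that] r_orth[OF that] hinner_commute[of "q j"] by (simp_all add: Suc)
      then have "hinner H ?s (q i) = 0" "hinner H ?s (r i) = 0"
        by (simp_all add: hinner_sum_left hinner_simps(3))
      then show ?thesis
        using that[of ?s] by (simp add: a_def Suc q)
    qed
    have "hinner H (r i) s = 0" "hinner H (q i) s = 0"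
      using sq sr hinner_commute[of _ s] by simp_all
    then have "hinner H (r i) (q i) = hinner H (r i) a"
      and "Re (hinner H a a) = Re (hinner H (q i) (q i)) + Re (hinner H s s)"
      using sq by (simp_all add: a hinner_simps)
    then show ?thesis
      unfolding r using hinner_ge0[of s] by (intro step_contraction) (simp_all add: a_def)
  qed
  show ?thesis
  proof (induction i)
    case (Suc i)
    then show ?case
      using step[of i] mult_left_mono[OF Suc.IH sqrt_rate_nonneg] by (simp add: mult.assoc)
  qed simp
qed

lemma gcr_bound:
  "hnorm H (gcr_r A H b x0 i) \<le> sqrt (rate A H) ^ i * hnorm H (b - A *v x0)"
  using truncated_orthogonalization_bound[of "gcr_r A H b x0" "gcr_q A H b x0" "\<lambda>_. 0"] by simp

lemma orthomin_bound:
  "hnorm H (orthomin_r A H b x0 k i) \<le> sqrt (rate A H) ^ i * hnorm H (b - A *v x0)"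
  using truncated_orthogonalization_bound[of "orthomin_r A H b x0 k" "orthomin_q A H b x0 k" "\<lambda>i. Suc i - k"]
  by (simp add: matrix_vector_mult_diff_distrib vec.linear_sum[OF matrix_vector_mul_linear_gen] vector_scalar_commute)

lemma mr_bound:
  "hnorm H (mr_r A H b x0 i) \<le> sqrt (rate A H) ^ i * hnorm H (b - A *v x0)"
  using truncated_orthogonalization_bound[of "mr_r A H b x0" "mr_q A H b x0" Suc] by simp

end

section \<open>Minimal residuals over closed convex sets\<close>

context weighted_problem
begin

lemma A_pos: "pos_def A"
  using M_pos Re_cinner_A by (simp add: pos_def_def)

text \<open>Existence is a compactness argument on a sublevel set, which is bounded because the residual norm
  controls the distance to the solution \<open>x'\<close>: by \<open>hermitian_pencil_max\<close>, \<open>|x' - x|^2\<close> is at most a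
  constant times \<open>||A (x' - x)||^2\<close>. Uniqueness is the parallelogram identity: the midpoint of two
  distinct minimizers would be better than both.\<close>

lemma ex1_minimal_residual:
  fixes W :: "(complex^'n) set"
  assumes "closed W" "convex W" "W \<noteq> {}"
  shows "\<exists>!x. x \<in> W \<and> (\<forall>y\<in>W. hnorm H (b - A *v x) \<le> hnorm H (b - A *v y))"
proof (rule ex_ex1I)
  let ?h = "\<lambda>x. Re (hinner H (b - A *v x) (b - A *v x))"
  define x' where "x' = matrix_inv A *v b"
  have x': "A *v x' = b"
    by (simp add: x'_def matrix_vector_mul_assoc pos_def_inv[OF A_pos])
  define G where "G = ctranspose A ** (H ** A)"
  have G: "cinner (G *v x) x = hinner H (A *v x) (A *v x)" for x
    by (simp add: G_def hinner_def matrix_vector_mul_assoc[symmetric] cinner_matrix_left[of "ctranspose A"])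
  have Gpos: "Re (cinner (G *v x) x) > 0" if "x \<noteq> 0" for x
    unfolding G using pos_def_inj[OF A_pos, of x 0] that by (intro hinner_pos) auto
  have "ctranspose G = G"
    by (simp add: G_def ctranspose_mult H_herm matrix_mul_assoc)
  moreover have "ctranspose (mat 1 :: complex^'n^'n) = mat 1"
    by (auto simp: ctranspose_def mat_def vec_eq_iff)
  ultimately obtain \<mu> where \<mu>: "\<And>x. Re (cinner x x) \<le> \<mu> * Re (cinner (G *v x) x)"
    using hermitian_pencil_max[of "mat 1" G] Gpos by (metis matrix_vector_mul_lid)
  obtain w where w: "w \<in> W"
    using assms(3) by blast
  let ?T = "{x \<in> W. ?h x \<le> ?h w}"
  have cont: "continuous_on UNIV ?h"
    unfolding hinner_def Re_cinner by (intro continuous_intros)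
  have "(norm (x' - x))\<^sup>2 \<le> \<bar>\<mu>\<bar> * ?h w" if "x \<in> ?T" for x
  proof -
    have h: "Re (cinner (G *v (x' - x)) (x' - x)) = ?h x"
      unfolding G by (simp add: matrix_vector_mult_diff_distrib x')
    have "(norm (x' - x))\<^sup>2 \<le> \<mu> * ?h x"
      using \<mu>[of "x' - x"] unfolding h by (simp add: Re_cinner power2_norm_eq_inner)
    also have "\<dots> \<le> \<bar>\<mu>\<bar> * ?h w"
      using that hinner_ge0 by (intro mult_mono) auto
    finally show ?thesis .
  qed
  then have "?T \<subseteq> cball x' (sqrt (\<bar>\<mu>\<bar> * ?h w))"
    unfolding subset_iff mem_cball dist_norm by (blast intro: real_le_rsqrt)
  then have "bounded ?T"
    using bounded_cball bounded_subset by blast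
  moreover have "closed ?T"
    using assms(1) closed_Collect_le[OF cont continuous_on_const, of "?h w"]
    by (simp add: Collect_conj_eq closed_Int)
  ultimately have "compact ?T"
    by (simp add: compact_eq_bounded_closed)
  moreover have "continuous_on ?T ?h"
    using cont continuous_on_subset by blast
  moreover have "?T \<noteq> {}"
    using w by auto
  ultimately have "\<exists>x\<in>?T. \<forall>y\<in>?T. ?h x \<le> ?h y"
    by (intro continuous_attains_inf)
  then obtain x where x: "x \<in> ?T" "\<forall>y\<in>?T. ?h x \<le> ?h y"
    by (rule bexE)
  then have "?h x \<le> ?h y" if "y \<in> W" for y
    using that by (cases "?h y \<le> ?h w") auto
  then show "\<exists>x. x \<in> W \<and> (\<forall>y\<in>W. hnorm H (b - A *v x) \<le> hnorm H (b - A *v y))"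
    using x(1) unfolding hnorm_def by auto
next
  let ?h = "\<lambda>x. Re (hinner H (b - A *v x) (b - A *v x))"
  fix x y
  assume x: "x \<in> W \<and> (\<forall>y\<in>W. hnorm H (b - A *v x) \<le> hnorm H (b - A *v y))"
    and y: "y \<in> W \<and> (\<forall>z\<in>W. hnorm H (b - A *v y) \<le> hnorm H (b - A *v z))"
  define u v where "u = b - A *v x" and "v = b - A *v y"
  define m where "m = of_real (1/2) *s x + of_real (1/2) *s y"
  have "m \<in> W"
    using x y assms(2) unfolding m_def of_real_scale by (intro convexD) auto
  have m: "b - A *v m = of_real (1/2) *s (u + v)"
    unfolding m_def u_def v_def matrix_vector_right_distrib vector_scalar_commute
    by (simp add: vec_eq_iff field_simps)
  have "?h x \<le> ?h m" "?h y \<le> ?h m"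
    using x y \<open>m \<in> W\<close> by (auto simp: hnorm_def)
  moreover have "4 * ?h m = 2 * ?h x + 2 * ?h y - Re (hinner H (u - v) (u - v))"
    unfolding m unfolding u_def[symmetric] v_def[symmetric] by (simp add: hinner_simps field_simps)
  ultimately have "Re (hinner H (u - v) (u - v)) \<le> 0"
    by linarith
  then have "u = v"
    using hinner_pos[of "u - v"] by fastforce
  then show "x = y"
    using pos_def_inj[OF A_pos, of x y] by (simp add: u_def v_def)
qed

end

section \<open>Krylov spaces over the scalar field\<close>

locale scalars =
  fixes K :: "complex set"
  assumes K: "K = \<real> \<or> K = UNIV"
begin

lemma closed_ops:
  "0 \<in> K" "x \<in> K \<Longrightarrow> y \<in> K \<Longrightarrow> x + y \<in> K" "x \<in> K \<Longrightarrow> y \<in> K \<Longrightarrow> x - y \<in> K"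
  "x \<in> K \<Longrightarrow> y \<in> K \<Longrightarrow> x * y \<in> K" "x \<in> K \<Longrightarrow> y \<in> K \<Longrightarrow> x / y \<in> K"
  "x \<in> K \<Longrightarrow> cnj x \<in> K" "of_real t \<in> K"
  using K by (auto simp: Reals_cnj_iff)

lemma sum_closed: "(\<And>j. j \<in> J \<Longrightarrow> f j \<in> K) \<Longrightarrow> (\<Sum>j\<in>J. f j) \<in> K"
  using K by auto

lemma vec_over_ops:
  "vec_over K x \<Longrightarrow> vec_over K y \<Longrightarrow> vec_over K (x + y)"
  "vec_over K x \<Longrightarrow> vec_over K y \<Longrightarrow> vec_over K (x - y)"
  "c \<in> K \<Longrightarrow> vec_over K x \<Longrightarrow> vec_over K (c *s x)"
  "mat_over K B \<Longrightarrow> vec_over K x \<Longrightarrow> vec_over K (B *v x)"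
  by (auto simp: vec_over_def mat_over_def matrix_vector_mult_def intro!: closed_ops sum_closed)

lemma vec_over_sum: "(\<And>j. j \<in> J \<Longrightarrow> vec_over K (f j)) \<Longrightarrow> vec_over K (\<Sum>j\<in>J. f j)"
  by (auto simp: vec_over_def intro!: sum_closed)

lemma hcoeff_closed:
  "mat_over K H \<Longrightarrow> vec_over K u \<Longrightarrow> vec_over K q \<Longrightarrow> hcoeff H u q \<in> K"
  unfolding hcoeff_def hinner_def cinner_def
  by (metis (no_types, lifting) closed_ops(4-6) sum_closed vec_over_def vec_over_ops(4))

lemma mat_over_herm_part:
  assumes "mat_over K B" shows "mat_over K (herm_part B)"
proof -
  have "herm_part B $ i $ j = of_real (1/2) * (B $ i $ j + cnj (B $ j $ i))" for i j
    by (simp add: herm_part_def ctranspose_def complex_eq_iff)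
  then show ?thesis
    using assms closed_ops(2,4,6,7) unfolding mat_over_def by metis
qed

lemma krylov_affine_over:
  assumes "mat_over K A" "mat_over K H" "vec_over K b" "vec_over K x0" "x \<in> krylov_affine K A H b x0 i"
  shows "vec_over K x"
proof -
  have "vec_over K (((\<lambda>v. (H ** A) *v v) ^^ j) (H *v (b - A *v x0)))" for j
    by (induction j) (simp_all add: vec_over_ops assms(1-4) matrix_vector_mul_assoc[symmetric])
  then show ?thesis
    using assms(4,5) by (auto simp: krylov_affine_def intro!: vec_over_ops vec_over_sum)
qed

text \<open>For either scalar field the set is a translate of a real subspace.\<close>

lemma krylov_affine_closed_convex:
  "closed (krylov_affine K A H b x0 i)" "convex (krylov_affine K A H b x0 i)"
  "x0 \<in> krylov_affine K A H b x0 i"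
proof -
  define v where "v j = ((\<lambda>v. (H ** A) *v v) ^^ j) (H *v (b - A *v x0))" for j
  define L where "L = {(\<Sum>j<i. c j *s v j) | c. \<forall>j. c j \<in> K}"
  have kr: "krylov_affine K A H b x0 i = (+) x0 ` L"
    by (auto simp: krylov_affine_def L_def v_def)
  have "subspace L"
  proof (rule subspaceI)
    show "0 \<in> L"
      unfolding L_def using closed_ops(1) by (auto intro!: exI[of _ "\<lambda>_. 0"])
  next
    fix x y assume "x \<in> L" "y \<in> L"
    then obtain c d where "x = (\<Sum>j<i. c j *s v j)" "y = (\<Sum>j<i. d j *s v j)"
      "\<forall>j. c j \<in> K" "\<forall>j. d j \<in> K"
      by (auto simp: L_def)
    then show "x + y \<in> L"
      unfolding L_def using closed_ops(2)
      by (auto intro!: exI[of _ "\<lambda>j. c j + d j"] simp: vec.scale_left_distrib sum.distrib)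
  next
    fix t :: real and x assume "x \<in> L"
    then obtain c where "x = (\<Sum>j<i. c j *s v j)" "\<forall>j. c j \<in> K"
      by (auto simp: L_def)
    then show "t *\<^sub>R x \<in> L"
      unfolding L_def using closed_ops(4,7)
      by (auto intro!: exI[of _ "\<lambda>j. of_real t * c j"] simp: of_real_scale[symmetric] vec.scale_sum_right)
  qed
  then show "closed (krylov_affine K A H b x0 i)" "convex (krylov_affine K A H b x0 i)"
    "x0 \<in> krylov_affine K A H b x0 i"
    unfolding kr using subspace_0[of L]
    by (auto intro: closed_translation closed_subspace convex_translation subspace_imp_convex)
qed

text \<open>The preconditioned residual of \<open>x = x0 + \<Sum> c j v j\<close> is \<open>v 0 - \<Sum> c j v (j + 1)\<close>, since \<open>H A\<close>
  shifts the Krylov vectors \<open>v j\<close>.\<close>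

lemma krylov_affine_step:
  assumes "x \<in> krylov_affine K A H b x0 i" "a \<in> K"
  shows "x + a *s (H *v (b - A *v x)) \<in> krylov_affine K A H b x0 (Suc i)"
proof -
  define v where "v j = ((\<lambda>v. (H ** A) *v v) ^^ j) (H *v (b - A *v x0))" for j
  obtain c where c: "x = x0 + (\<Sum>j<i. c j *s v j)" "\<forall>j. c j \<in> K"
    using assms(1) by (auto simp: krylov_affine_def v_def)
  have vSuc: "H *v (A *v v j) = v (Suc j)" for j
    by (simp add: v_def matrix_vector_mul_assoc)
  have "H *v (b - A *v x) = v 0 - (\<Sum>j<i. c j *s v (Suc j))"
    by (simp add: c(1) v_def[of 0] matrix_vector_mult_diff_distrib matrix_vector_right_distrib
        vec.linear_sum[OF matrix_vector_mul_linear_gen] vector_scalar_commute vSuc)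
  moreover define d where
    "d j = (if j < i then c j else 0) + (case j of 0 \<Rightarrow> a | Suc l \<Rightarrow> - a * c l)" for j
  have "(\<Sum>j<Suc i. d j *s v j)
      = (\<Sum>j<i. c j *s v j) + (a *s v 0 + (\<Sum>j<i. (- a * c j) *s v (Suc j)))"
  proof -
    have "(\<Sum>j<Suc i. d j *s v j) = (\<Sum>j<Suc i. (if j < i then c j else 0) *s v j)
        + (\<Sum>j<Suc i. (case j of 0 \<Rightarrow> a | Suc l \<Rightarrow> - a * c l) *s v j)"
      by (simp add: d_def vec.scale_left_distrib sum.distrib)
    then show ?thesis
      by (subst (asm) (3) sum.lessThan_Suc_shift) simp
  qed
  ultimately have "x + a *s (H *v (b - A *v x)) = x0 + (\<Sum>j<Suc i. d j *s v j)"
    by (simp add: c(1) vec.scale_right_diff_distrib vec.scale_sum_right sum_negf)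
  moreover have "d j \<in> K" for j
    using c(2) assms(2) closed_ops(3)[of 0 "a * c l" for l] closed_ops(1,2,4)
    by (auto simp: d_def split: nat.split)
  ultimately show ?thesis
    unfolding krylov_affine_def v_def by blast
qed

end

section \<open>GMRES\<close>

locale weighted_problem_over = scalars K + weighted_problem A H
  for K :: "complex set" and A H :: "complex^'n^'n" +
  fixes b :: "complex^'n"
  assumes A_over: "mat_over K A" and H_over: "mat_over K H" and b_over: "vec_over K b"
begin

text \<open>The coefficients of an MR step must lie in the scalar field for the step to stay in the Krylov space;
  they do because all data, hence all iterates, are over that field.\<close>

lemma mr_x_krylov:
  assumes "vec_over K x0"
  shows "mr_x A H b x0 i \<in> krylov_affine K A H b x0 i"
proof (induction i)
  case 0
  show ?case
    using krylov_affine_closed_convex(3) by simp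
next
  case (Suc i)
  have "vec_over K (mr_x A H b x0 i)"
    using krylov_affine_over Suc A_over H_over b_over assms by blast
  then have "vec_over K (mr_r A H b x0 i)"
    unfolding mr_r_eq by (intro vec_over_ops A_over b_over)
  then have "hcoeff H (mr_r A H b x0 i) (mr_q A H b x0 i) \<in> K"
    by (simp add: hcoeff_closed vec_over_ops A_over H_over)
  then show ?case
    using krylov_affine_step[OF Suc] by (simp add: mr_r_eq)
qed

lemma gmres_x_minimal:
  "gmres_x K A H b x0 i \<in> krylov_affine K A H b x0 i"
  "y \<in> krylov_affine K A H b x0 i \<Longrightarrow> hnorm H (gmres_r K A H b x0 i) \<le> hnorm H (b - A *v y)"
proof -
  have "\<exists>!x. x \<in> krylov_affine K A H b x0 i
      \<and> (\<forall>y\<in>krylov_affine K A H b x0 i. hnorm H (b - A *v x) \<le> hnorm H (b - A *v y))"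
    using krylov_affine_closed_convex by (intro ex1_minimal_residual) blast+
  from theI'[OF this]
  show "gmres_x K A H b x0 i \<in> krylov_affine K A H b x0 i"
    "y \<in> krylov_affine K A H b x0 i \<Longrightarrow> hnorm H (gmres_r K A H b x0 i) \<le> hnorm H (b - A *v y)"
    unfolding gmres_r_def gmres_x_def by blast+
qed

lemma gmres_bound:
  assumes "vec_over K x0"
  shows "hnorm H (gmres_r K A H b x0 i) \<le> sqrt (rate A H) ^ i * hnorm H (b - A *v x0)"
  using gmres_x_minimal(2)[OF mr_x_krylov[OF assms]] mr_bound[of b x0 i]
  unfolding mr_r_eq by (rule order_trans)

lemma gmres_x_over: "vec_over K x0 \<Longrightarrow> vec_over K (gmres_x K A H b x0 i)"
  using krylov_affine_over gmres_x_minimal(1) A_over H_over b_over by blast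

end

section \<open>Restarting\<close>

text \<open>The predicate \<open>P\<close> carries what the method needs of an initial guess from one cycle to the next; for
  GMRES this is that the guess lies over the scalar field.\<close>

lemma restart_bound:
  fixes S :: "complex^'n \<Rightarrow> nat \<Rightarrow> complex^'n" and f :: "complex^'n \<Rightarrow> real"
  assumes "s \<ge> 0" and "P x0"
    and P: "\<And>y j. P y \<Longrightarrow> P (S y j)" and f: "\<And>y j. P y \<Longrightarrow> f (S y j) \<le> s ^ j * f y"
  shows "f (S (cycle_start S m x0 (i div m)) (i mod m)) \<le> s ^ i * f x0"
proof -
  have start: "P (cycle_start S m x0 c) \<and> f (cycle_start S m x0 c) \<le> s ^ (m * c) * f x0" for c
  proof (induction c)
    case (Suc c)
    have "f (cycle_start S m x0 (Suc c)) \<le> s ^ m * f (cycle_start S m x0 c)"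
      using f Suc by simp
    also have "\<dots> \<le> s ^ m * (s ^ (m * c) * f x0)"
      using Suc assms(1) by (intro mult_left_mono) auto
    finally show ?case
      using P Suc by (simp add: power_add)
  qed (use assms in simp)
  let ?y = "cycle_start S m x0 (i div m)"
  have "f (S ?y (i mod m)) \<le> s ^ (i mod m) * f ?y"
    using f start by blast
  also have "\<dots> \<le> s ^ (i mod m) * (s ^ (m * (i div m)) * f x0)"
    using start assms(1) by (intro mult_left_mono) auto
  also have "\<dots> = s ^ (i mod m + m * (i div m)) * f x0"
    by (simp only: power_add mult.assoc)
  finally show ?thesis
    by (simp only: mod_mult_div_eq)
qed

section \<open>The residual bound for all methods\<close>

theorem theorem6:
  fixes K :: "complex set" and A H :: "complex^'n^'n" and b x0 :: "complex^'n"
  assumes "K = \<real> \<or> K = UNIV"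
    and "mat_over K A" and "mat_over K H" and "vec_over K b" and "vec_over K x0"
    and "hpd K (herm_part A)" and "hpd K H"
    and "b - A *v x0 \<noteq> 0"
  shows
    "(\<forall>i. gcr_defined A H b x0 i \<longrightarrow>
        hnorm H (gcr_r A H b x0 i) / hnorm H (b - A *v x0) \<le> sqrt (rate A H) ^ i)
   \<and> (\<forall>i. hnorm H (gmres_r K A H b x0 i) / hnorm H (b - A *v x0) \<le> sqrt (rate A H) ^ i)
   \<and> (\<forall>k i. gcr_restart_defined A H b x0 k i \<longrightarrow>
        hnorm H (gcr_restart_r A H b x0 k i) / hnorm H (b - A *v x0) \<le> sqrt (rate A H) ^ i)
   \<and> (\<forall>k i. hnorm H (gmres_restart_r K A H b x0 k i) / hnorm H (b - A *v x0)
        \<le> sqrt (rate A H) ^ i)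
   \<and> (\<forall>k\<ge>1. \<forall>i. orthomin_defined A H b x0 k i \<longrightarrow>
        hnorm H (orthomin_r A H b x0 k i) / hnorm H (b - A *v x0) \<le> sqrt (rate A H) ^ i)
   \<and> (\<forall>i. mr_defined A H b x0 i \<longrightarrow>
        hnorm H (mr_r A H b x0 i) / hnorm H (b - A *v x0) \<le> sqrt (rate A H) ^ i)"
proof -
  interpret scalars K
    by unfold_locales (rule assms(1))
  interpret weighted_problem_over K A H b
    using assms(2-4,6,7) pos_def_over[OF assms(1)] mat_over_herm_part
    by unfold_locales (auto simp: hpd_def)
  have gcr_restart: "hnorm H (gcr_restart_r A H b x0 k i)
      \<le> sqrt (rate A H) ^ i * hnorm H (b - A *v x0)" for k i
    unfolding gcr_restart_r_eq gcr_restart_x_def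
    by (rule restart_bound[where P = "\<lambda>_. True" and f = "\<lambda>x. hnorm H (b - A *v x)"])
      (use gcr_bound sqrt_rate_nonneg in \<open>simp_all only: gcr_r_eq\<close>)
  have gmres_restart: "hnorm H (gmres_restart_r K A H b x0 k i)
      \<le> sqrt (rate A H) ^ i * hnorm H (b - A *v x0)" for k i
    unfolding gmres_restart_r_def gmres_restart_x_def
    by (rule restart_bound[where P = "vec_over K" and f = "\<lambda>x. hnorm H (b - A *v x)"])
      (use gmres_bound gmres_x_over sqrt_rate_nonneg assms(5) in \<open>simp_all only: gmres_r_def\<close>)
  have "hnorm H (b - A *v x0) > 0"
    using hinner_pos[OF assms(8)] by (simp add: hnorm_def)
  then show ?thesis
    using gcr_bound gmres_bound[OF assms(5)] gcr_restart gmres_restart orthomin_bound mr_bound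
    by (simp add: pos_divide_le_eq)
qed

end
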